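(* Let $q=p^s$ with $p$ an odd prime and $s\ge1$, let $k\geq1$ be an integer, and let $$\widetilde N^*(k,0)=\#\{(x_1,\dots,x_k)\in(\mathbb{F}_q^* )^k\mid x_1^2+\cdots+x_k^2=0,\ x_i\ne x_j\text{ for all }i\neq j\}.$$ (1) If either $p\equiv1\pmod4$, or $p\equiv3\pmod4$ and $s$ is even, then $$\widetilde N^*(k,0)=\frac{(q-1)_k}{q}+(-1)^k\frac{q-1}{2q}\Big\{A_{k,1}(1-\sqrt q,1+\sqrt q,1-q)+A_{k,1}(1+\sqrt q,1-\sqrt q,1-q)\Big\}.$$ (2) If $p\equiv3\pmod4$ and $s$ is odd, then $$\widetilde N^*(k,0)=\frac{(q-1)_k}{q}+(-1)^k\frac{q-1}{2q}\Big\{A_{k,1}(1-\sqrt q i,1+\sqrt q i,1-q)+A_{k,1}(1+\sqrt q i,1-\sqrt q i,1-q)\Big\},$$ where $i=\sqrt{-1}$.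
   Context: $(x)_k=x(x-1)\cdots(x-k+1)$. $\chi$ denotes the quadratic character of $\mathbb{F}_q^*$, and for an integer $j$, $\chi(j)$ means $\chi$ evaluated at the image of $j$ in $\mathbb{F}_q$. For integers $c_1,\dots,c_k\geq 0$ with $\sum_j jc_j=k$, let $N(c_1,\dots,c_k)=\frac{k!}{1^{c_1}c_1!\,2^{c_2}c_2!\cdots k^{c_k}c_k!}$. For $b\in\mathbb{F}_q^*$ and complex $u,v,w$, define $$A_{k,b}(u,v,w)=\sum_{c_1,\dots,c_k\ge 0,\ \sum_j jc_j=k}N(c_1,\dots,c_k)\,t_1^{c_1}\cdots t_k^{c_k},$$ where $t_j=u$ if $p\nmid j$ and $\chi(j)=\chi(b)$; $t_j=v$ if $p\nmid j$ and $\chi(j)=-\chi(b)$; $t_j=w$ if $p\mid j$. (So $A_{k,1}$ uses $\chi(b)=1$.) *)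

theory Defs
  imports
    Complex_Main
    "HOL-Library.FuncSet"
    "HOL-Library.Cardinality"
    "HOL-Number_Theory.Number_Theory"
begin

definition falling_fact :: "'a::comm_ring_1 \<Rightarrow> nat \<Rightarrow> 'a" where
  "falling_fact x k = (\<Prod>i<k. x - of_nat i)"

(* Extended by 0 at 0, as usual; only the values on nonzero elements are used below. *)
definition quad_char :: "'a::field \<Rightarrow> int" where
  "quad_char x = (if x = 0 then 0 else if \<exists>y. x = y\<^sup>2 then 1 else -1)"

(* Tuples (c_1,...,c_k) are extensional functions on {1..k}. *)
definition cycle_types :: "nat \<Rightarrow> (nat \<Rightarrow> nat) set" where
  "cycle_types k = {c \<in> {1..k} \<rightarrow>\<^sub>E UNIV. (\<Sum>j=1..k. j * c j) = k}"

definition cycle_type_count :: "nat \<Rightarrow> (nat \<Rightarrow> nat) \<Rightarrow> complex" where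
  "cycle_type_count k c = fact k / (\<Prod>j=1..k. of_nat j ^ c j * fact (c j))"

(* For b nonzero and p the characteristic of the field, the last branch is exactly the
   case quad_char (of_nat j) = - quad_char b. *)
definition cycle_weight ::
  "nat \<Rightarrow> 'a::field \<Rightarrow> complex \<Rightarrow> complex \<Rightarrow> complex \<Rightarrow> nat \<Rightarrow> complex" where
  "cycle_weight p b u v w j =
     (if p dvd j then w
      else if quad_char (of_nat j :: 'a) = quad_char b then u
      else v)"

definition A_poly ::
  "nat \<Rightarrow> nat \<Rightarrow> 'a::field \<Rightarrow> complex \<Rightarrow> complex \<Rightarrow> complex \<Rightarrow> complex" where
  "A_poly p k b u v w =
     (\<Sum>c\<in>cycle_types k. cycle_type_count k c * (\<Prod>j=1..k. cycle_weight p b u v w j ^ c j))"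

definition num_distinct_nonzero_sols :: "nat \<Rightarrow> 'a::{field,finite} \<Rightarrow> nat" where
  "num_distinct_nonzero_sols k b =
     card {x \<in> {1..k} \<rightarrow>\<^sub>E (UNIV - {0::'a}).
             (\<Sum>i=1..k. (x i)\<^sup>2) = b \<and> (\<forall>i\<in>{1..k}. \<forall>j\<in>{1..k}. i \<noteq> j \<longrightarrow> x i \<noteq> x j)}"

lemma finite_cycle_types: "finite (cycle_types k)"
proof (rule finite_subset)
  show "cycle_types k \<subseteq> {1..k} \<rightarrow>\<^sub>E {..k}"
  proof
    fix c assume c: "c \<in> cycle_types k"
    have "c j \<le> k" if j: "j \<in> {1..k}" for j
    proof -
      have "c j \<le> j * c j" using j by simp
      also have "\<dots> \<le> (\<Sum>j=1..k. j * c j)"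
        using j by (intro member_le_sum) auto
      also have "\<dots> = k" using c by (simp add: cycle_types_def)
      finally show ?thesis .
    qed
    then show "c \<in> {1..k} \<rightarrow>\<^sub>E {..k}"
      using c by (auto simp: cycle_types_def PiE_iff)
  qed
qed (auto intro: finite_PiE)

end

theory Submission
  imports Defs "HOL-Computational_Algebra.Polynomial"
begin

text \<open>
  Let \<open>\<psi>\<close> be a nontrivial additive character of the field. By orthogonality the number of
  solutions is \<open>1/q\<close> times the sum over all \<open>a\<close> of the sums of \<open>\<Prod>i. \<psi> (a * (x i)\<^sup>2)\<close> over
  tuples of distinct nonzero elements. Such a sum is \<open>k!\<close> times an elementary symmetric function,
  which by Newton's identities is a signed cycle index polynomial in the power sums; and the
  \<open>j\<close>-th power sum is \<open>G (a * j) - 1\<close> with \<open>G b = (\<Sum>x. \<psi> (b * x\<^sup>2))\<close>. Now \<open>G 0 = q\<close>,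
  \<open>G b = \<chi> b * G 1\<close> for nonzero \<open>b\<close>, and \<open>G 1 * G (-1) = q\<close>, so \<open>(G 1)\<^sup>2 = \<chi> (-1) * q\<close>. The sign of
  \<open>G 1\<close> is irrelevant because half of the nonzero \<open>a\<close> have \<open>\<chi> a = 1\<close> and half have \<open>\<chi> a = -1\<close>.
\<close>

section \<open>Sums over injective tuples and the cycle index\<close>

text \<open>Sums products over ordered tuples of distinct elements. Deleting the chosen element from
  the set replaces the injectivity condition, so plain induction on the length applies.\<close>

fun inj_sum :: "('a \<Rightarrow> 'b::comm_ring_1) \<Rightarrow> nat \<Rightarrow> 'a set \<Rightarrow> 'b" where
  "inj_sum f 0 X = 1"
| "inj_sum f (Suc n) X = (\<Sum>x\<in>X. f x * inj_sum f n (X - {x}))"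

lemma inj_sum_eq:
  assumes "finite X"
  shows "(\<Sum>x | x \<in> {1..k} \<rightarrow>\<^sub>E X \<and> inj_on x {1..k}. \<Prod>i=1..k. f (x i)) = inj_sum f k X"
  using assms
proof (induction k arbitrary: X)
  case 0
  show ?case by simp
next
  case (Suc k)
  have ins: "{1..Suc k} = insert (Suc k) {1..k}" by auto
  have notin: "Suc k \<notin> {1..k}" by simp
  let ?S = "{(y, g). y \<in> X \<and> g \<in> {1..k} \<rightarrow>\<^sub>E (X - {y}) \<and> inj_on g {1..k}}"
  \<comment> \<open>An injective tuple is its last entry \<open>y\<close> together with an injective
    tuple that avoids \<open>y\<close>.\<close>
  have "(\<Sum>x | x \<in> {1..Suc k} \<rightarrow>\<^sub>E X \<and> inj_on x {1..Suc k}. \<Prod>i=1..Suc k. f (x i)) =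
        (\<Sum>x\<in>(\<lambda>(y, g). g(Suc k := y)) ` ?S. \<Prod>i=1..Suc k. f (x i))"
    unfolding ins extensional_funcset_extend_domain_inj_on_eq[OF notin] ..
  also have "\<dots> = (\<Sum>(y, g)\<in>?S. f y * (\<Prod>i=1..k. f (g i)))"
    using extensional_funcset_extend_domain_inj_onI[OF notin, of X]
    by (subst sum.reindex) (auto intro!: sum.cong prod.cong simp: mult.commute)
  also have "?S = (SIGMA y:X. {g. g \<in> {1..k} \<rightarrow>\<^sub>E (X - {y}) \<and> inj_on g {1..k}})"
    by auto
  also have "(\<Sum>(y, g)\<in>\<dots>. f y * (\<Prod>i=1..k. f (g i))) =
      (\<Sum>y\<in>X. \<Sum>g | g \<in> {1..k} \<rightarrow>\<^sub>E (X - {y}) \<and> inj_on g {1..k}. f y * (\<Prod>i=1..k. f (g i)))"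
  proof (rule sum.Sigma[symmetric])
    have "finite ({1..k} \<rightarrow>\<^sub>E (X - {y}))" for y
      using Suc.prems by (intro finite_PiE) auto
    then show "\<forall>y\<in>X. finite {g. g \<in> {1..k} \<rightarrow>\<^sub>E (X - {y}) \<and> inj_on g {1..k}}"
      by auto
  qed (use Suc.prems in auto)
  also have "\<dots> = inj_sum f (Suc k) X"
    using Suc by (simp flip: sum_distrib_left)
  finally show ?case .
qed

text \<open>One entry can be chosen in \<open>card X\<close> ways, the others from a set with one
  element less. This evaluates the term of the trivial character, \<open>a = 0\<close>, in the final
  count.\<close>

lemma inj_sum_const_1:
  assumes "finite X"
  shows "inj_sum (\<lambda>_. 1) n X = (falling_fact (of_nat (card X)) n :: 'b::comm_ring_1)"
  using assms
proof (induction n arbitrary: X)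
  case 0
  show ?case by (simp add: falling_fact_def)
next
  case (Suc n)
  have "inj_sum (\<lambda>_. 1::'b) n (X - {x}) = falling_fact (of_nat (card X) - 1) n"
    if "x \<in> X" for x
  proof -
    have "card X > 0" using that Suc.prems card_gt_0_iff by blast
    then show ?thesis using that Suc.prems
      by (simp add: Suc.IH of_nat_diff)
  qed
  then have "inj_sum (\<lambda>_. 1::'b) (Suc n) X = of_nat (card X) * falling_fact (of_nat (card X) - 1) n"
    by simp
  also have "\<dots> = falling_fact (of_nat (card X)) (Suc n)"
    unfolding falling_fact_def prod.lessThan_Suc_shift by (simp add: algebra_simps)
  finally show ?case .
qed

text \<open>A tuple with distinct entries either avoids \<open>x\<close> or has it in exactly one of
  \<open>Suc n\<close> positions.\<close>

lemma inj_sum_remove: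
  assumes "finite X" "x \<in> X"
  shows "inj_sum f (Suc n) X =
    inj_sum f (Suc n) (X - {x}) + of_nat (Suc n) * f x * inj_sum f n (X - {x})"
  using assms
proof (induction n arbitrary: X)
  case 0
  then show ?case by (simp add: sum.remove[of X x])
next
  case (Suc n)
  have comm: "X - {y} - {x} = X - {x} - {y}" for y by auto
  have "inj_sum f (Suc (Suc n)) X =
      f x * inj_sum f (Suc n) (X - {x}) + (\<Sum>y\<in>X-{x}. f y * inj_sum f (Suc n) (X - {y}))"
    using Suc.prems by (subst inj_sum.simps(2), subst sum.remove[of X x]) auto
  also have "(\<Sum>y\<in>X-{x}. f y * inj_sum f (Suc n) (X - {y})) =
      (\<Sum>y\<in>X-{x}. f y * (inj_sum f (Suc n) (X - {x} - {y}) +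
         of_nat (Suc n) * f x * inj_sum f n (X - {x} - {y})))"
  proof (rule sum.cong)
    fix y assume "y \<in> X - {x}"
    then have "x \<in> X - {y}" using Suc.prems by auto
    then show "f y * inj_sum f (Suc n) (X - {y}) =
      f y * (inj_sum f (Suc n) (X - {x} - {y}) + of_nat (Suc n) * f x * inj_sum f n (X - {x} - {y}))"
      using Suc.IH[of "X - {y}"] Suc.prems by (simp only: comm finite_Diff)
  qed simp
  also have "\<dots> = inj_sum f (Suc (Suc n)) (X - {x}) +
      of_nat (Suc n) * f x * inj_sum f (Suc n) (X - {x})"
    by (simp add: distrib_left sum.distrib sum_distrib_left mult_ac del: of_nat_Suc)
  finally show ?case by (simp add: algebra_simps)
qed

section \<open>Elementary symmetric functions and Newton's identities\<close>

text \<open>This is \<open>(-1)\<^sup>n\<close> times the \<open>n\<close>-th elementary symmetric function of the values of \<open>f\<close>.\<close>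

definition sgn_elem :: "('a \<Rightarrow> complex) \<Rightarrow> nat \<Rightarrow> 'a set \<Rightarrow> complex" where
  "sgn_elem f n X = (-1) ^ n * inj_sum f n X / fact n"

text \<open>The values \<open>sgn_elem f n X\<close> are the coefficients of the product of the
  factors 1 - f(y) z over y in X; this splits off the factor of \<open>x\<close>.\<close>

lemma sgn_elem_remove:
  assumes "finite X" "x \<in> X"
  shows "sgn_elem f (Suc n) X = sgn_elem f (Suc n) (X - {x}) - f x * sgn_elem f n (X - {x})"
proof -
  have cancel: "(- e) * (a + N * y * b) / (N * F) = (- e) * a / (N * F) - y * (e * b / F)"
    if "N \<noteq> 0" "F \<noteq> 0" for e a N y b F :: complex
    using that by (simp add: field_simps)
  show ?thesis
    unfolding sgn_elem_def inj_sum_remove[OF assms] fact_Suc power_Suc of_nat_mult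
    using cancel[of "of_nat (Suc n)" "fact n" "(-1) ^ n"]
    by (simp del: inj_sum.simps of_nat_Suc)
qed

text \<open>Solving \<open>sgn_elem_remove\<close> for the term on \<open>X - {x}\<close> and
  unrolling it expresses that term by values on all of \<open>X\<close>. Each unrolling raises the
  exponent of \<open>f x\<close> by one, which is why \<open>j\<close> is arbitrary in the
  induction.\<close>

lemma power_sum_mult_sgn_elem:
  assumes "finite X"
  shows "(\<Sum>x\<in>X. f x ^ j * sgn_elem f n (X - {x})) =
    (\<Sum>i\<le>n. (\<Sum>x\<in>X. f x ^ (j + i)) * sgn_elem f (n - i) X)"
proof (induction n arbitrary: j)
  case 0
  show ?case by (simp add: sgn_elem_def)
next
  case (Suc n)
  have "(\<Sum>x\<in>X. f x ^ j * sgn_elem f (Suc n) (X - {x})) =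
      (\<Sum>x\<in>X. f x ^ j * sgn_elem f (Suc n) X + f x ^ Suc j * sgn_elem f n (X - {x}))"
    using assms by (intro sum.cong) (auto simp: sgn_elem_remove[of X] algebra_simps)
  also have "\<dots> = (\<Sum>x\<in>X. f x ^ j) * sgn_elem f (Suc n) X +
      (\<Sum>i\<le>n. (\<Sum>x\<in>X. f x ^ (Suc j + i)) * sgn_elem f (n - i) X)"
    by (simp only: sum.distrib sum_distrib_right[symmetric] Suc.IH)
  also have "\<dots> = (\<Sum>i\<le>Suc n. (\<Sum>x\<in>X. f x ^ (j + i)) * sgn_elem f (Suc n - i) X)"
    by (subst sum.atMost_Suc_shift) simp
  finally show ?case .
qed

text \<open>The recursion of \<open>inj_sum\<close> writes the left side as minus the sum of
  \<open>f x * sgn_elem f (n - 1) (X - {x})\<close>; the previous lemma with exponent 1 then expands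
  it in power sums.\<close>

lemma newton_identity:
  assumes "finite X"
  shows "of_nat n * sgn_elem f n X = (\<Sum>j=1..n. - (\<Sum>x\<in>X. f x ^ j) * sgn_elem f (n - j) X)"
proof (cases n)
  case (Suc m)
  have "of_nat n * sgn_elem f n X = - (\<Sum>x\<in>X. f x ^ 1 * sgn_elem f m (X - {x}))"
    unfolding Suc sgn_elem_def
    by (simp add: sum_distrib_left sum_divide_distrib field_simps sum_negf del: of_nat_Suc)
  also have "\<dots> = - (\<Sum>i\<le>m. (\<Sum>x\<in>X. f x ^ (1 + i)) * sgn_elem f (m - i) X)"
    by (simp only: power_sum_mult_sgn_elem[OF assms])
  also have "\<dots> = (\<Sum>j=1..n. - (\<Sum>x\<in>X. f x ^ j) * sgn_elem f (n - j) X)"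
    unfolding sum_negf[symmetric] Suc
    by (rule sum.reindex_bij_witness[of _ "\<lambda>j. j - 1" Suc]) (auto simp: sum_negf)
  finally show ?thesis .
qed simp

section \<open>The cycle index and its recursion\<close>

text \<open>
  The number \<open>K\<close> of available part sizes is kept independent of the weight \<open>n\<close>: the recursion for the
  cycle index lowers \<open>n\<close>, and extensional functions on a fixed domain need no re-indexing.
\<close>

definition weighted_comps :: "nat \<Rightarrow> nat \<Rightarrow> (nat \<Rightarrow> nat) set" where
  "weighted_comps K n = {c \<in> {1..K} \<rightarrow>\<^sub>E UNIV. (\<Sum>j=1..K. j * c j) = n}"

definition cycle_index :: "nat \<Rightarrow> (nat \<Rightarrow> complex) \<Rightarrow> nat \<Rightarrow> complex" where
  "cycle_index K t n =
     (\<Sum>c\<in>weighted_comps K n. \<Prod>j=1..K. t j ^ c j / (of_nat j ^ c j * fact (c j)))"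

lemma finite_weighted_comps: "finite (weighted_comps K n)"
proof (rule finite_subset)
  show "weighted_comps K n \<subseteq> {1..K} \<rightarrow>\<^sub>E {..n}"
  proof
    fix c assume c: "c \<in> weighted_comps K n"
    have "c j \<le> n" if j: "j \<in> {1..K}" for j
    proof -
      have "c j \<le> j * c j" using j by simp
      also have "\<dots> \<le> (\<Sum>j=1..K. j * c j)"
        using j by (intro member_le_sum) auto
      also have "\<dots> = n" using c by (simp add: weighted_comps_def)
      finally show ?thesis .
    qed
    then show "c \<in> {1..K} \<rightarrow>\<^sub>E {..n}"
      using c by (auto simp: weighted_comps_def PiE_iff)
  qed
qed (auto intro: finite_PiE)

lemma cycle_index_0: "cycle_index K t 0 = 1"
proof -
  have "weighted_comps K 0 = {\<lambda>j\<in>{1..K}. 0}"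
    by (auto simp: weighted_comps_def PiE_iff extensional_def fun_eq_iff)
  then show ?thesis by (simp add: cycle_index_def)
qed

text \<open>Removing one part of size \<open>i\<close> lowers \<open>c i\<close> by one. The factor
  \<open>i * c i\<close> is exactly what this removes from \<open>i ^ c i * fact (c i)\<close>, and
  it kills the terms that have no such part.\<close>

lemma cycle_index_remove_part:
  assumes i: "i \<in> {1..K}" and "i \<le> n"
  shows "(\<Sum>c\<in>weighted_comps K n. of_nat (i * c i) *
            (\<Prod>j=1..K. t j ^ c j / (of_nat j ^ c j * fact (c j)))) =
         t i * cycle_index K t (n - i)"
proof -
  let ?w = "\<lambda>c j. t j ^ c j / (of_nat j ^ c j * fact (c j))"
  let ?S = "{c\<in>weighted_comps K n. c i > 0}"
  have split_sum: "(\<Sum>j=1..K. j * c j) = i * c i + (\<Sum>j\<in>{1..K}-{i}. j * c j)" for c :: "nat \<Rightarrow> nat"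
    using i by (simp add: sum.remove)
  have split_prod: "(\<Prod>j=1..K. ?w c j) = ?w c i * (\<Prod>j\<in>{1..K}-{i}. ?w c j)" for c
    using i by (simp add: prod.remove)
  have "(\<Sum>c\<in>weighted_comps K n. of_nat (i * c i) * (\<Prod>j=1..K. ?w c j)) =
        (\<Sum>c\<in>?S. of_nat (i * c i) * (\<Prod>j=1..K. ?w c j))"
    by (rule sum.mono_neutral_right) (auto simp: finite_weighted_comps)
  also have "\<dots> = (\<Sum>c\<in>weighted_comps K (n - i). t i * (\<Prod>j=1..K. ?w c j))"
  proof (rule sum.reindex_bij_witness[of _ "\<lambda>c. c(i := Suc (c i))" "\<lambda>c. c(i := c i - 1)"])
    fix c assume c: "c \<in> ?S"
    then obtain d where d: "c i = Suc d" by (auto simp: gr0_conv_Suc)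
    show "(c(i := c i - 1))(i := Suc ((c(i := c i - 1)) i)) = c"
      using d by auto
    show "c(i := c i - 1) \<in> weighted_comps K (n - i)"
      using c d i split_sum[of c] split_sum[of "c(i := c i - 1)"]
      by (auto simp: weighted_comps_def PiE_iff extensional_def)
    have "of_nat (i * c i) * ?w c i = t i * ?w (c(i := c i - 1)) i"
    proof -
      have cancel: "I * N * (T * P / (I * Q * (N * F))) = T * (P / (Q * F))"
        if "I \<noteq> 0" "N \<noteq> 0" for I N T P Q F :: complex
        using that by (simp add: divide_simps)
      show ?thesis
        using cancel[of "of_nat i" "of_nat (Suc d)" "t i"] i d
        by (simp del: of_nat_Suc mult_Suc_right)
    qed
    then show "t i * (\<Prod>j=1..K. ?w (c(i := c i - 1)) j) = of_nat (i * c i) * (\<Prod>j=1..K. ?w c j)"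
      by (simp only: split_prod mult.assoc[symmetric]) (auto intro!: prod.cong)
  next
    fix c assume c: "c \<in> weighted_comps K (n - i)"
    show "(c(i := Suc (c i)))(i := (c(i := Suc (c i))) i - 1) = c" by auto
    show "c(i := Suc (c i)) \<in> ?S"
      using c i split_sum[of c] split_sum[of "c(i := Suc (c i))"] \<open>i \<le> n\<close>
      by (auto simp: weighted_comps_def PiE_iff extensional_def)
  qed
  also have "\<dots> = t i * cycle_index K t (n - i)"
    by (simp add: cycle_index_def sum_distrib_left)
  finally show ?thesis .
qed

text \<open>In each term \<open>n\<close> is the sum of all \<open>i * c i\<close>; exchanging the
  two sums reduces the claim to removing one part. The bound \<open>n \<le> K\<close> makes every
  part size up to \<open>n\<close> available.\<close>

lemma cycle_index_rec:
  assumes "n \<le> K"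
  shows "of_nat n * cycle_index K t n = (\<Sum>j=1..n. t j * cycle_index K t (n - j))"
proof -
  let ?w = "\<lambda>c. \<Prod>j=1..K. t j ^ c j / (of_nat j ^ c j * fact (c j))"
  have "of_nat n * cycle_index K t n = (\<Sum>c\<in>weighted_comps K n. \<Sum>i=1..K. of_nat (i * c i) * ?w c)"
    unfolding cycle_index_def sum_distrib_left sum_distrib_right[symmetric] of_nat_sum[symmetric]
    by (rule sum.cong) (auto simp: weighted_comps_def)
  also have "\<dots> = (\<Sum>i=1..K. \<Sum>c\<in>weighted_comps K n. of_nat (i * c i) * ?w c)"
    by (rule sum.swap)
  also have "\<dots> = (\<Sum>i=1..n. \<Sum>c\<in>weighted_comps K n. of_nat (i * c i) * ?w c)"
  proof (rule sum.mono_neutral_right)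
    show "\<forall>i\<in>{1..K} - {1..n}. (\<Sum>c\<in>weighted_comps K n. of_nat (i * c i) * ?w c) = 0"
    proof (intro ballI sum.neutral)
      fix i c assume i: "i \<in> {1..K} - {1..n}" and c: "c \<in> weighted_comps K n"
      have "i * c i \<le> (\<Sum>j=1..K. j * c j)"
        using i by (intro member_le_sum) auto
      also have "\<dots> = n" using c by (simp add: weighted_comps_def)
      \<comment> \<open>With the bound in this form \<open>i\<close> cancels and
        \<open>c i < 1\<close> remains.\<close>
      also have "n < i * 1" using i by auto
      finally have "c i = 0" unfolding nat_mult_less_cancel_disj by simp
      then show "of_nat (i * c i) * ?w c = 0" by simp
    qed
  qed (use assms in auto)
  also have "\<dots> = (\<Sum>j=1..n. t j * cycle_index K t (n - j))"
    using assms by (intro sum.cong refl cycle_index_remove_part) auto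
  finally show ?thesis .
qed

text \<open>Both sides have the value 1 at 0 and satisfy the same recursion, Newton's identity on
  one side and \<open>cycle_index_rec\<close> on the other.\<close>

lemma sgn_elem_eq_cycle_index:
  assumes "finite X" "n \<le> K"
  shows "sgn_elem f n X = cycle_index K (\<lambda>j. - (\<Sum>x\<in>X. f x ^ j)) n"
  using \<open>n \<le> K\<close>
proof (induction n rule: less_induct)
  case (less n)
  show ?case
  proof (cases "n = 0")
    case True
    then show ?thesis by (simp add: cycle_index_0 sgn_elem_def)
  next
    case False
    have "of_nat n * sgn_elem f n X =
        of_nat n * cycle_index K (\<lambda>j. - (\<Sum>x\<in>X. f x ^ j)) n"
      unfolding newton_identity[OF \<open>finite X\<close>] cycle_index_rec[OF less.prems]
      using less by (intro sum.cong) auto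
    then show ?thesis using False by simp
  qed
qed

lemma inj_sum_cycle_types:
  assumes "finite X"
  shows "inj_sum f k X = (-1) ^ k * (\<Sum>c\<in>cycle_types k. cycle_type_count k c *
    (\<Prod>j=1..k. (- (\<Sum>x\<in>X. f x ^ j)) ^ c j))"
proof -
  have "inj_sum f k X = (-1) ^ k * (fact k * sgn_elem f k X)"
    by (simp add: sgn_elem_def flip: power_mult_distrib mult.assoc)
  also have "fact k * sgn_elem f k X = (\<Sum>c\<in>cycle_types k. cycle_type_count k c *
    (\<Prod>j=1..k. (- (\<Sum>x\<in>X. f x ^ j)) ^ c j))"
    unfolding sgn_elem_eq_cycle_index[OF assms order_refl] cycle_index_def sum_distrib_left
      weighted_comps_def cycle_types_def cycle_type_count_def
    by (simp add: prod_dividef)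
  finally show ?thesis .
qed

section \<open>Additive characters of finite fields\<close>

lemma CARD_field_ge_2: "CARD('a::{field,finite}) \<ge> 2"
  using card_mono[of UNIV "{0, 1::'a}"] by simp

lemma finite_field_power_CARD:
  fixes x :: "'a::{field,finite}"
  assumes "x \<noteq> 0"
  shows "x ^ (CARD('a) - 1) = 1"
proof -
  \<comment> \<open>Multiplication by \<open>x\<close> permutes the nonzero elements.\<close>
  have "(\<Prod>y\<in>UNIV-{0}. x * y) = (\<Prod>y\<in>UNIV-{0}. y)"
    by (rule prod.reindex_bij_witness[of _ "\<lambda>y. y / x" "\<lambda>y. x * y"]) (use assms in auto)
  moreover have "(\<Prod>y\<in>UNIV-{0}. x * y) = x ^ (CARD('a) - 1) * \<Prod>(UNIV-{0})"
    by (simp add: prod.distrib)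
  ultimately show ?thesis by simp
qed

lemma prime_CHAR_finite: "prime CHAR('a::{field,finite})"
  using prime_CHAR_semidom finite_imp_CHAR_pos by (metis finite_class.finite_UNIV)

section \<open>The prime subfield, the trace, and a nontrivial character\<close>

text \<open>The images of 0, ..., p - 1 are p distinct roots of X^p - X, which has at most p roots,
  so they are all of them.\<close>

lemma prime_subfield:
  fixes y :: "'a::{field,finite}"
  assumes "y ^ CHAR('a) = y"
  shows "\<exists>n. y = of_nat n"
proof -
  define p where "p = CHAR('a)"
  have p: "prime p" unfolding p_def by (rule prime_CHAR_finite)
  then have p2: "p \<ge> 2" by (rule prime_ge_2_nat)
  let ?P = "monom (1::'a) p - monom 1 1"
  have deg: "degree ?P = p"
    using p2 degree_add_eq_left[of "- monom (1::'a) 1" "monom 1 p"] by (simp add: degree_monom_eq)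
  then have "?P \<noteq> 0" using p2 by auto
  then have le: "card {x. poly ?P x = 0} \<le> p"
    using card_poly_roots_bound deg by metis
  have of_nat_pow: "(of_nat n :: 'a) ^ p = of_nat n" for n
    using p by (induction n) (auto simp: p_def power_0_left freshmans_dream[OF prime_CHAR_finite])
  have "inj_on (of_nat :: nat \<Rightarrow> 'a) {..<p}"
    unfolding inj_on_def of_nat_eq_iff_cong_CHAR p_def[symmetric]
    by (auto simp: cong_less_modulus_unique_nat)
  then have "card (of_nat ` {..<p} :: 'a set) = p" by (simp add: card_image)
  moreover have sub: "(of_nat ` {..<p} :: 'a set) \<subseteq> {x. poly ?P x = 0}"
    by (auto simp: poly_monom of_nat_pow)
  ultimately have "of_nat ` {..<p} = {x. poly ?P x = 0}"
    using le by (intro card_subset_eq) (auto dest: card_mono[OF finite])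
  moreover have "y \<in> {x. poly ?P x = 0}" using assms by (simp add: poly_monom p_def)
  ultimately show ?thesis by blast
qed

text \<open>For a field with \<open>CHAR('a) ^ s\<close> elements this is the absolute trace, kept
  as an element of the field itself.\<close>

definition field_trace :: "nat \<Rightarrow> 'a::{field,finite} \<Rightarrow> 'a" where
  "field_trace s x = (\<Sum>i<s. x ^ (CHAR('a) ^ i))"

lemma field_trace_add: "field_trace s (x + y) = field_trace s x + field_trace s y"
  by (simp add: field_trace_def freshmans_dream'[OF prime_CHAR_finite] sum.distrib)

lemma field_trace_0: "field_trace s 0 = 0"
  by (metis add_0 add_cancel_left_left field_trace_add)

text \<open>The Frobenius map shifts the summands cyclically, since the power
  \<open>CHAR('a) ^ s\<close> fixes \<open>x\<close>. Hence the trace lies in the prime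
  subfield.\<close>

lemma field_trace_power_CHAR:
  assumes "CARD('a) = CHAR('a) ^ s"
  shows "field_trace s (x::'a::{field,finite}) ^ CHAR('a) = field_trace s x"
proof -
  have xq: "x ^ (CHAR('a) ^ s) = x"
  proof (cases "x = 0")
    case True
    then show ?thesis using prime_gt_0_nat[OF prime_CHAR_finite[where ?'a='a]] by simp
  next
    case False
    have "x ^ CARD('a) = x * x ^ (CARD('a) - 1)"
      by (metis power_minus_mult mult.commute finite_UNIV_card_ge_0 finite)
    then show ?thesis using finite_field_power_CARD[OF False] assms by simp
  qed
  have "field_trace s x ^ CHAR('a) = (\<Sum>i<s. x ^ (CHAR('a) ^ Suc i))"
    unfolding field_trace_def freshmans_dream_sum[OF prime_CHAR_finite refl]
    by (simp add: mult.commute flip: power_mult)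
  also have "\<dots> = (\<Sum>i<Suc s. x ^ (CHAR('a) ^ i)) - x"
    by (subst sum.lessThan_Suc_shift) simp
  also have "\<dots> = field_trace s x"
    using xq by (simp add: field_trace_def)
  finally show ?thesis .
qed

text \<open>The trace is a nonzero polynomial of degree at most p^(s-1), too small for all p^s
  elements to be roots.\<close>

lemma field_trace_nonzero:
  assumes "CARD('a) = CHAR('a) ^ s"
  shows "\<exists>x::'a::{field,finite}. field_trace s x \<noteq> 0"
proof (rule ccontr)
  assume "\<not> ?thesis"
  then have tr0: "field_trace s (x::'a) = 0" for x by blast
  define p where "p = CHAR('a)"
  have p2: "p \<ge> 2" unfolding p_def by (rule prime_ge_2_nat[OF prime_CHAR_finite])
  obtain r where r: "s = Suc r"
    using assms CARD_field_ge_2[where ?'a='a] by (cases s) auto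
  let ?P = "\<Sum>i<s. monom (1::'a) (p ^ i)"
  have "coeff ?P (p ^ r) = 1"
    using p2 by (simp add: coeff_sum r power_inject_exp)
  then have "?P \<noteq> 0" by auto
  have "poly ?P x = 0" for x
    using tr0[of x] by (simp add: poly_sum poly_monom field_trace_def p_def)
  then have "CARD('a) \<le> degree ?P"
    using card_poly_roots_bound[OF \<open>?P \<noteq> 0\<close>] by simp
  also have "\<dots> \<le> p ^ r"
    using p2 by (intro degree_sum_le) (auto simp: degree_monom_eq r power_increasing)
  also have "\<dots> < p ^ s" using p2 by (simp add: r)
  finally show False using assms by (simp add: p_def)
qed

locale nontrivial_additive_character =
  fixes \<psi> :: "'a::{field,finite} \<Rightarrow> complex"
  assumes \<psi>_0: "\<psi> 0 = 1"
    and \<psi>_add: "\<psi> (x + y) = \<psi> x * \<psi> y"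
    and \<psi>_nontrivial: "\<exists>x. \<psi> x \<noteq> 1"

text \<open>The character is \<open>\<omega>\<close> to the power of the trace, for a primitive p-th
  root of unity \<open>\<omega>\<close>. The trace is read as a natural number \<open>n x\<close>,
  whose choice modulo p does not matter.\<close>

lemma nontrivial_additive_character_exists:
  assumes card: "CARD('a::{field,finite}) = CHAR('a) ^ s"
  shows "\<exists>\<psi> :: 'a \<Rightarrow> complex. nontrivial_additive_character \<psi>"
proof -
  define p where "p = CHAR('a)"
  have p: "prime p" unfolding p_def by (rule prime_CHAR_finite)
  then have p2: "p \<ge> 2" by (rule prime_ge_2_nat)
  define \<omega> where "\<omega> = cis (2 * pi / real p)"
  have \<omega>_p: "\<omega> ^ p = 1" using p2 by (simp add: \<omega>_def DeMoivre)
  have \<omega>_cong: "\<omega> ^ a = \<omega> ^ b" if "[a = b] (mod p)" for a b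
  proof -
    have "\<omega> ^ n = \<omega> ^ (n mod p)" for n
      by (metis \<omega>_p div_mult_mod_eq mult_1 power_add power_mult power_one mult.commute)
    then show ?thesis using that by (metis cong_def)
  qed
  have "\<omega> \<noteq> 1"
  proof
    assume "\<omega> = 1"
    have "inj_on (\<lambda>k. cis (2 * pi * real k / real p)) {..<p}"
      using bij_betw_roots_unity[of p] p2 by (simp add: bij_betw_def)
    from inj_onD[OF this, of 1 0] show False
      using \<open>\<omega> = 1\<close> p2 by (simp add: \<omega>_def)
  qed
  have "\<exists>n. field_trace s x = of_nat n" for x :: 'a
    using prime_subfield field_trace_power_CHAR[OF card] by blast
  then obtain n where n: "field_trace s x = of_nat (n x)" for x :: 'a by metis
  show ?thesis
  proof (rule exI[of _ "\<lambda>x. \<omega> ^ n x"], unfold_locales)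
    have "[n 0 = 0] (mod p)"
      using n[of 0] unfolding p_def of_nat_eq_iff_cong_CHAR[symmetric] field_trace_0 by simp
    then show "\<omega> ^ n 0 = 1" using \<omega>_cong by fastforce
    show "\<omega> ^ n (x + y) = \<omega> ^ n x * \<omega> ^ n y" for x y
    proof -
      have "[n (x + y) = n x + n y] (mod p)"
        unfolding p_def of_nat_eq_iff_cong_CHAR[symmetric] of_nat_add n[symmetric] field_trace_add ..
      then show ?thesis using \<omega>_cong by (metis power_add)
    qed
    obtain x :: 'a where "field_trace s x \<noteq> 0" using field_trace_nonzero[OF card] by blast
    then have "\<not> p dvd n x" unfolding n p_def of_nat_eq_0_iff_char_dvd .
    then have "coprime (n x) p" using p by (simp add: prime_imp_coprime coprime_commute)
    \<comment> \<open>Raising to the power \<open>u\<close> turns \<open>\<omega> ^ n x\<close> back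
      into \<open>\<omega>\<close>, which is not 1.\<close>
    then obtain u where u: "[n x * u = 1] (mod p)" using cong_solve_coprime_nat by auto
    have "\<omega> ^ n x \<noteq> 1"
    proof
      assume "\<omega> ^ n x = 1"
      then have "\<omega> ^ (n x * u) = 1" by (simp add: power_mult)
      then show False using \<omega>_cong[OF u] \<open>\<omega> \<noteq> 1\<close> by simp
    qed
    then show "\<exists>x. \<omega> ^ n x \<noteq> 1" by blast
  qed
qed

section \<open>The quadratic character\<close>

context
  assumes odd_card: "odd CARD('a::{field,finite})"
begin

lemma two_neq_0: "(2::'a) \<noteq> 0"
proof
  assume "(2::'a) = 0"
  then have "of_nat 2 = (0::'a)" by simp
  then have "CHAR('a) dvd 2" unfolding of_nat_eq_0_iff_char_dvd .
  then have "CHAR('a) = 2" using prime_CHAR_finite[where ?'a='a] primes_dvd_imp_eq two_is_prime_nat by blast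
  then show False using CHAR_dvd_CARD[where ?'a='a] odd_card by simp
qed

lemma neg_neq: "x \<noteq> 0 \<Longrightarrow> - x \<noteq> (x::'a)"
  using two_neq_0 by (metis add.right_inverse mult_2 mult_eq_0_iff)

text \<open>The convention \<open>quad_char 0 = 0\<close> makes the formula right for the single
  root of 0 as well.\<close>

lemma card_square_roots: "int (card {x::'a. x\<^sup>2 = y}) = 1 + quad_char y"
proof -
  consider "y = 0" | z where "y = z\<^sup>2" "z \<noteq> 0" | "\<nexists>z. y = z\<^sup>2" by fastforce
  then show ?thesis
  proof cases
    case 2
    then have "{x. x\<^sup>2 = y} = {z, - z}" by (auto simp: power2_eq_iff)
    then show ?thesis using 2 neg_neq[of z] by (auto simp: quad_char_def)
  next
    case 3
    then have "{x. x\<^sup>2 = y} = {}" by auto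
    then show ?thesis using 3 by (auto simp: quad_char_def)
  qed (simp add: quad_char_def)
qed

lemma sum_over_squares:
  fixes f :: "'a \<Rightarrow> complex"
  shows "(\<Sum>x\<in>UNIV. f (x\<^sup>2)) = (\<Sum>y\<in>UNIV. (1 + of_int (quad_char y)) * f y)"
proof -
  have "(\<Sum>x\<in>UNIV. f (x\<^sup>2)) = (\<Sum>y\<in>UNIV. \<Sum>x\<in>{x. x\<^sup>2 = y}. f (x\<^sup>2))"
    using sum.group[of UNIV UNIV "\<lambda>x::'a. x\<^sup>2" "\<lambda>x. f (x\<^sup>2)"] by simp
  also have "\<dots> = (\<Sum>y\<in>UNIV. of_int (int (card {x::'a. x\<^sup>2 = y})) * f y)"
    by simp
  finally show ?thesis by (simp only: card_square_roots) simp
qed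

lemma sum_quad_char: "(\<Sum>y\<in>UNIV. quad_char (y::'a)) = 0"
proof -
  have "complex_of_int (\<Sum>y\<in>UNIV. quad_char (y::'a)) = 0"
    using sum_over_squares[of "\<lambda>_. 1"] by (simp add: sum.distrib)
  then show ?thesis by (simp only: of_int_eq_0_iff)
qed

lemma card_quad_char:
  "2 * card {x::'a. quad_char x = 1} = CARD('a) - 1"
  "2 * card {x::'a. quad_char x = -1} = CARD('a) - 1"
proof -
  let ?S = "{x::'a. quad_char x = 1}" and ?N = "{x::'a. quad_char x = -1}"
  have U: "(UNIV::'a set) = insert 0 (?S \<union> ?N)" by (auto simp: quad_char_def)
  have disj: "?S \<inter> ?N = {}" "0 \<notin> ?S \<union> ?N" by (auto simp: quad_char_def)
  have "(\<Sum>y\<in>insert 0 (?S \<union> ?N). quad_char y) = int (card ?S) - int (card ?N)"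
    using disj by (simp add: sum.union_disjoint) (simp add: quad_char_def)
  then have "card ?S = card ?N" using sum_quad_char U by simp
  moreover have "CARD('a) = 1 + card ?S + card ?N"
    by (subst U) (use disj in \<open>simp add: card_Un_disjoint\<close>)
  ultimately show "2 * card ?S = CARD('a) - 1" "2 * card ?N = CARD('a) - 1" by simp_all
qed

text \<open>With m = (q - 1)/2, the m nonzero squares are roots of X^m - 1 and so exhaust its roots.
  For a non-square, x^m squares to 1 without being 1, hence is -1.\<close>

lemma euler_criterion_finite_field:
  assumes "x \<noteq> 0"
  shows "x ^ ((CARD('a) - 1) div 2) = (of_int (quad_char x) :: 'a)"
proof -
  define m where "m = (CARD('a) - 1) div 2"
  have m: "CARD('a) - 1 = m * 2" using odd_card by (auto simp: m_def elim!: oddE)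
  have m0: "m \<noteq> 0"
    using m CARD_field_ge_2[where ?'a='a] by auto
  let ?S = "{x::'a. quad_char x = 1}" and ?P = "monom (1::'a) m - 1"
  have "degree ?P = m"
    using m0 degree_add_eq_left[of "- 1 :: 'a poly" "monom 1 m"] by (simp add: degree_monom_eq)
  moreover from this have "?P \<noteq> 0" using m0 by auto
  ultimately have le: "card {x. poly ?P x = 0} \<le> m" using card_poly_roots_bound by metis
  have "?S \<subseteq> {x. poly ?P x = 0}"
  proof
    fix x :: 'a assume "x \<in> ?S"
    then obtain y where "x = y\<^sup>2" "x \<noteq> 0" by (auto simp: quad_char_def split: if_splits)
    then have "x ^ m = y ^ (CARD('a) - 1)" "y \<noteq> 0"
      unfolding m by (auto simp: mult.commute simp flip: power_mult)
    then show "x \<in> {x. poly ?P x = 0}"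
      using finite_field_power_CARD[of y] by (simp add: poly_monom)
  qed
  moreover have "card ?S = m" using card_quad_char(1) m by simp
  ultimately have eq: "?S = {x. poly ?P x = 0}"
    using le by (intro card_subset_eq) (auto dest: card_mono[OF finite])
  have "(x ^ m)\<^sup>2 = 1"
    using finite_field_power_CARD[OF assms] m by (simp add: power_mult)
  then have "x ^ m = 1 \<or> x ^ m = -1" by (simp add: power2_eq_1_iff)
  moreover have "quad_char x = 1 \<longleftrightarrow> x ^ m = 1"
    using eq by (auto simp: set_eq_iff poly_monom)
  moreover have "quad_char x = 1 \<or> quad_char x = -1" using assms by (auto simp: quad_char_def)
  ultimately show ?thesis unfolding m_def[symmetric] by auto
qed

text \<open>Euler's criterion yields equalities in the field only; since 1 and -1 differ there,
  equalities of signs lift to the integers.\<close>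

lemma of_int_unit_inj:
  assumes "(of_int a :: 'a) = of_int b" "a \<in> {-1, 1}" "b \<in> {-1, 1}"
  shows "a = b"
  using assms neg_neq[of 1] neg_neq[of 1, symmetric] by auto

lemma quad_char_mult:
  assumes "x \<noteq> 0" "y \<noteq> 0"
  shows "quad_char (x * y :: 'a) = quad_char x * quad_char y"
proof (rule of_int_unit_inj)
  show "(of_int (quad_char (x * y)) :: 'a) = of_int (quad_char x * quad_char y)"
    using assms by (simp add: power_mult_distrib flip: euler_criterion_finite_field)
qed (use assms in \<open>auto simp: quad_char_def\<close>)

lemma quad_char_neg_1: "quad_char (-1::'a) = (-1) ^ ((CARD('a) - 1) div 2)"
proof (rule of_int_unit_inj)
  show "(of_int (quad_char (-1::'a)) :: 'a) = of_int ((-1) ^ ((CARD('a) - 1) div 2))"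
    by (simp flip: euler_criterion_finite_field)
qed (auto simp: quad_char_def minus_one_power_iff)

end

section \<open>Quadratic Gauss sums\<close>

context nontrivial_additive_character
begin

lemma sum_\<psi>: "(\<Sum>x\<in>UNIV. \<psi> x) = 0"
proof -
  obtain z where z: "\<psi> z \<noteq> 1" using \<psi>_nontrivial by blast
  have "\<psi> z * (\<Sum>x\<in>UNIV. \<psi> x) = (\<Sum>x\<in>UNIV. \<psi> (z + x))"
    by (simp add: \<psi>_add sum_distrib_left)
  also have "\<dots> = (\<Sum>x\<in>UNIV. \<psi> x)"
    by (rule sum.reindex_bij_witness[of _ "\<lambda>x. x - z" "\<lambda>x. z + x"]) auto
  finally show ?thesis using z by simp
qed

lemma sum_\<psi>_mult: "(\<Sum>x\<in>UNIV. \<psi> (a * x)) = (if a = 0 then of_nat CARD('a) else 0)"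
proof (cases "a = 0")
  case False
  then have "(\<Sum>x\<in>UNIV. \<psi> (a * x)) = (\<Sum>x\<in>UNIV. \<psi> x)"
    by (intro sum.reindex_bij_witness[of _ "\<lambda>x. x / a" "\<lambda>x. a * x"]) auto
  then show ?thesis using False sum_\<psi> by simp
qed (simp add: \<psi>_0)

lemma \<psi>_sum: "\<psi> (\<Sum>i\<in>I. h i) = (\<Prod>i\<in>I. \<psi> (h i))"
  by (induction I rule: infinite_finite_induct) (auto simp: \<psi>_0 \<psi>_add)

lemma \<psi>_power: "\<psi> x ^ n = \<psi> (of_nat n * x)"
  by (induction n) (auto simp: \<psi>_0 \<psi>_add distrib_right)

definition gauss :: "'a \<Rightarrow> complex" where
  "gauss b = (\<Sum>x\<in>UNIV. \<psi> (b * x\<^sup>2))"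

lemma gauss_0: "gauss 0 = of_nat CARD('a)"
  by (simp add: gauss_def \<psi>_0)

lemma gauss_eq_quad_char:
  assumes "odd CARD('a)" "b \<noteq> 0"
  shows "gauss b = of_int (quad_char b) * gauss 1"
proof -
  \<comment> \<open>The summand 1 in the number of square roots contributes a full character sum,
    which vanishes for nonzero \<open>c\<close>.\<close>
  have eq: "gauss c = (\<Sum>y\<in>UNIV. of_int (quad_char y) * \<psi> (c * y))" if "c \<noteq> 0" for c
    using that sum_\<psi>_mult[of c] unfolding gauss_def
    by (subst sum_over_squares[OF assms(1)]) (simp add: distrib_right sum.distrib)
  have "of_int (quad_char b) * gauss b = (\<Sum>y\<in>UNIV. of_int (quad_char (b * y)) * \<psi> (b * y))"
    unfolding eq[OF assms(2)] sum_distrib_left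
  proof (intro sum.cong refl)
    fix y
    show "of_int (quad_char b) * (of_int (quad_char y) * \<psi> (b * y)) =
        of_int (quad_char (b * y)) * \<psi> (b * y)"
      by (cases "y = 0") (use assms in \<open>auto simp: quad_char_mult quad_char_def[of 0]\<close>)
  qed
  also have "\<dots> = gauss 1"
    unfolding eq[OF one_neq_zero]
    by (rule sum.reindex_bij_witness[of _ "\<lambda>x. x / b" "\<lambda>x. b * x"]) (use assms in auto)
  finally have *: "of_int (quad_char b) * gauss b = gauss 1" .
  have "quad_char b * quad_char b = 1" using assms(2) by (simp add: quad_char_def)
  then have "of_int (quad_char b) * of_int (quad_char b) = (1::complex)"
    by (metis of_int_1 of_int_mult)
  then show ?thesis by (simp flip: * mult.assoc)
qed

text \<open>The product is a double sum over x^2 - y^2 = (x + y)(x - y). As 2 is invertible, u = x +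
  y and v = x - y are free variables, and only u = 0 survives the sum over v.\<close>

lemma gauss_mult_gauss_neg:
  assumes "odd CARD('a)"
  shows "gauss 1 * gauss (-1) = of_nat CARD('a)"
proof -
  have "gauss 1 * gauss (-1) = (\<Sum>(x, y)\<in>UNIV. \<psi> ((x + y) * (x - y)))"
    by (simp add: gauss_def sum_product sum.cartesian_product algebra_simps power2_eq_square
        flip: \<psi>_add)
  also have "\<dots> = (\<Sum>(u, v)\<in>UNIV. \<psi> (u * v))"
    using two_neq_0[OF assms] no_zero_divisors[of "2::'a" 2]
    by (intro sum.reindex_bij_witness[of _ "\<lambda>(u, v). ((u + v) / 2, (u - v) / 2)"
          "\<lambda>(x, y). (x + y, x - y)"]) (auto simp: field_simps)
  also have "\<dots> = (\<Sum>u\<in>UNIV. \<Sum>v\<in>UNIV. \<psi> (u * v))"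
    by (simp add: sum.cartesian_product)
  also have "\<dots> = of_nat CARD('a)" by (simp add: sum_\<psi>_mult)
  finally show ?thesis .
qed

end

section \<open>Counting solutions\<close>

lemma (in nontrivial_additive_character) num_distinct_nonzero_sols_eq_sum:
  "of_nat CARD('a) * of_nat (num_distinct_nonzero_sols k (b::'a)) =
     (\<Sum>a\<in>UNIV. \<psi> (- a * b) * inj_sum (\<lambda>x. \<psi> (a * x\<^sup>2)) k (UNIV - {0}))"
proof -
  let ?D = "{x. x \<in> {1..k} \<rightarrow>\<^sub>E (UNIV - {0::'a}) \<and> inj_on x {1..k}}"
  have fin: "finite ?D"
    by (rule finite_subset[of _ "{1..k} \<rightarrow>\<^sub>E (UNIV - {0::'a})"]) (auto intro: finite_PiE)
  have sols: "{x \<in> {1..k} \<rightarrow>\<^sub>E (UNIV - {0::'a}). (\<Sum>i=1..k. (x i)\<^sup>2) = b \<and>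
      (\<forall>i\<in>{1..k}. \<forall>j\<in>{1..k}. i \<noteq> j \<longrightarrow> x i \<noteq> x j)} = {x\<in>?D. (\<Sum>i=1..k. (x i)\<^sup>2) = b}"
    by (auto simp: inj_on_def)
  have "(\<Sum>a\<in>UNIV. \<psi> (- a * b) * inj_sum (\<lambda>x. \<psi> (a * x\<^sup>2)) k (UNIV - {0})) =
      (\<Sum>a\<in>UNIV. \<Sum>x\<in>?D. \<psi> (- a * b) * (\<Prod>i=1..k. \<psi> (a * (x i)\<^sup>2)))"
    by (simp add: sum_distrib_left flip: inj_sum_eq)
  also have "\<dots> = (\<Sum>a\<in>UNIV. \<Sum>x\<in>?D. \<psi> (((\<Sum>i=1..k. (x i)\<^sup>2) - b) * a))"
    by (intro sum.cong refl)
      (simp add: algebra_simps sum_distrib_left flip: \<psi>_sum \<psi>_add)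
  \<comment> \<open>After the exchange, the sum over \<open>a\<close> is q for solutions and 0 for
    all other tuples.\<close>
  also have "\<dots> = (\<Sum>x\<in>?D. \<Sum>a\<in>UNIV. \<psi> (((\<Sum>i=1..k. (x i)\<^sup>2) - b) * a))"
    by (rule sum.swap)
  also have "\<dots> = (\<Sum>x\<in>?D. if (\<Sum>i=1..k. (x i)\<^sup>2) = b then of_nat CARD('a) else 0)"
    by (simp only: sum_\<psi>_mult) simp
  also have "\<dots> = of_nat CARD('a) * of_nat (card {x\<in>?D. (\<Sum>i=1..k. (x i)\<^sup>2) = b})"
    using fin by (subst sum.inter_filter[symmetric]) auto
  finally show ?thesis
    unfolding num_distinct_nonzero_sols_def sols ..
qed

lemma (in nontrivial_additive_character) inj_sum_eq_A_poly:
  assumes odd: "odd CARD('a)" and "a \<noteq> 0"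
  defines "g \<equiv> of_int (quad_char a) * gauss 1"
  shows "inj_sum (\<lambda>x. \<psi> (a * x\<^sup>2)) k (UNIV - {0}) =
    (-1) ^ k * A_poly CHAR('a) k (1::'a) (1 - g) (1 + g) (1 - of_nat CARD('a))"
proof -
  have power_sum: "- (\<Sum>x\<in>UNIV - {0}. \<psi> (a * x\<^sup>2) ^ j) =
      cycle_weight CHAR('a) (1::'a) (1 - g) (1 + g) (1 - of_nat CARD('a)) j" for j
  proof -
    \<comment> \<open>The power \<open>j\<close> becomes a factor of the argument of
      \<open>\<psi>\<close>; the 1 subtracted is the term of x = 0.\<close>
    have "(\<Sum>x\<in>UNIV - {0}. \<psi> (a * x\<^sup>2) ^ j) = gauss (of_nat j * a) - 1"
      by (simp add: gauss_def sum_diff1 \<psi>_power \<psi>_0 mult.assoc)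
    moreover have "gauss (of_nat j * a) = (if CHAR('a) dvd j then of_nat CARD('a)
        else of_int (quad_char (of_nat j :: 'a)) * g)"
    proof (cases "CHAR('a) dvd j")
      case True
      then have "of_nat j = (0::'a)" by (simp add: of_nat_eq_0_iff_char_dvd)
      then show ?thesis using True by (simp add: gauss_0)
    next
      case False
      then have "of_nat j \<noteq> (0::'a)" by (simp add: of_nat_eq_0_iff_char_dvd)
      then show ?thesis using False assms
        by (simp add: gauss_eq_quad_char[of "of_nat j * a"] quad_char_mult)
    qed
    moreover have "quad_char (1::'a) = 1" by (auto simp: quad_char_def intro: exI[of _ 1])
    moreover have "quad_char (of_nat j :: 'a) \<in> {1, -1}" if "\<not> CHAR('a) dvd j"
      using that by (auto simp: quad_char_def of_nat_eq_0_iff_char_dvd)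
    ultimately show ?thesis by (auto simp: cycle_weight_def)
  qed
  show ?thesis
    by (subst inj_sum_cycle_types) (simp_all only: finite power_sum A_poly_def)
qed

lemma (in nontrivial_additive_character) num_distinct_nonzero_sols_0:
  assumes odd: "odd CARD('a)"
  shows "of_nat (num_distinct_nonzero_sols k (0::'a)) =
    falling_fact (of_nat CARD('a) - 1) k / of_nat CARD('a)
    + (-1) ^ k * ((of_nat CARD('a) - 1) / (2 * of_nat CARD('a))) *
      (A_poly CHAR('a) k (1::'a) (1 - gauss 1) (1 + gauss 1) (1 - of_nat CARD('a))
     + A_poly CHAR('a) k (1::'a) (1 + gauss 1) (1 - gauss 1) (1 - of_nat CARD('a)))"
proof -
  define q where "q = CARD('a)"
  let ?A = "A_poly CHAR('a) k (1::'a) (1 - gauss 1) (1 + gauss 1) (1 - of_nat q)"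
  let ?B = "A_poly CHAR('a) k (1::'a) (1 + gauss 1) (1 - gauss 1) (1 - of_nat q)"
  let ?I = "\<lambda>a::'a. inj_sum (\<lambda>x. \<psi> (a * x\<^sup>2)) k (UNIV - {0})"
  let ?S = "{x::'a. quad_char x = 1}" and ?N = "{x::'a. quad_char x = -1}"
  have q0: "q > 0" by (simp add: q_def)
  have U: "(UNIV::'a set) = insert 0 (?S \<union> ?N)" by (auto simp: quad_char_def)
  have disj: "?S \<inter> ?N = {}" "0 \<notin> ?S \<union> ?N" by (auto simp: quad_char_def)
  have "of_nat (2 * card ?S) = (of_nat q - 1 :: complex)"
    "of_nat (2 * card ?N) = (of_nat q - 1 :: complex)"
    unfolding card_quad_char[OF odd] q_def[symmetric] using q0 by (simp_all add: of_nat_diff)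
  then have cards: "of_nat (card ?S) = (of_nat q - 1 :: complex) / 2"
    "of_nat (card ?N) = (of_nat q - 1 :: complex) / 2"
    by (simp_all add: field_simps)
  have I0: "?I 0 = falling_fact (of_nat q - 1) k"
    using q0 by (simp add: \<psi>_0 inj_sum_const_1 q_def of_nat_diff)
  have IS: "?I a = (-1) ^ k * ?A" if "a \<in> ?S" for a
    using that inj_sum_eq_A_poly[OF odd, of a k] disj by (auto simp: q_def)
  \<comment> \<open>Here \<open>quad_char a = -1\<close> changes the sign of the Gauss sum, which
    swaps the first two weights.\<close>
  have IN: "?I a = (-1) ^ k * ?B" if "a \<in> ?N" for a
    using that inj_sum_eq_A_poly[OF odd, of a k] disj by (auto simp: q_def)
  have "of_nat q * of_nat (num_distinct_nonzero_sols k (0::'a)) = (\<Sum>a\<in>UNIV. ?I a)"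
    using num_distinct_nonzero_sols_eq_sum[of k 0] by (simp add: \<psi>_0 q_def)
  also have "\<dots> = ?I 0 + ((\<Sum>a\<in>?S. ?I a) + (\<Sum>a\<in>?N. ?I a))"
    by (subst U, subst sum.insert) (use disj in \<open>simp_all add: sum.union_disjoint\<close>)
  also have "\<dots> = falling_fact (of_nat q - 1) k
      + (of_nat (card ?S) * ((-1) ^ k * ?A) + of_nat (card ?N) * ((-1) ^ k * ?B))"
    by (simp only: I0 IS IN sum_constant cong: sum.cong)
  finally have "of_nat (num_distinct_nonzero_sols k (0::'a)) =
      (falling_fact (of_nat q - 1) k
      + ((of_nat q - 1) / 2 * ((-1) ^ k * ?A) + (of_nat q - 1) / 2 * ((-1) ^ k * ?B))) / of_nat q"
    using q0 unfolding cards by (simp add: eq_divide_eq mult.commute)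
  also have "\<dots> = falling_fact (of_nat q - 1) k / of_nat q
    + (-1) ^ k * ((of_nat q - 1) / (2 * of_nat q)) * (?A + ?B)"
    using q0 by (simp add: field_simps)
  finally show ?thesis unfolding q_def .
qed

theorem theorem4p6:
  fixes p s q k :: nat
  assumes "prime p" and "odd p" and "s \<ge> 1" and "q = p ^ s"
    and "CARD('a::{field,finite}) = q"
    and "k \<ge> 1"
  shows
    "([p = 1] (mod 4) \<or> ([p = 3] (mod 4) \<and> even s) \<longrightarrow>
        of_nat (num_distinct_nonzero_sols k (0::'a)) =
          falling_fact (of_nat q - 1) k / of_nat q
          + (-1) ^ k * ((of_nat q - 1) / (2 * of_nat q)) *
            (A_poly p k (1::'a) (1 - complex_of_real (sqrt (real q)))
                                (1 + complex_of_real (sqrt (real q))) (1 - of_nat q)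
           + A_poly p k (1::'a) (1 + complex_of_real (sqrt (real q)))
                                (1 - complex_of_real (sqrt (real q))) (1 - of_nat q)))
     \<and> ([p = 3] (mod 4) \<and> odd s \<longrightarrow>
        of_nat (num_distinct_nonzero_sols k (0::'a)) =
          falling_fact (of_nat q - 1) k / of_nat q
          + (-1) ^ k * ((of_nat q - 1) / (2 * of_nat q)) *
            (A_poly p k (1::'a) (1 - complex_of_real (sqrt (real q)) * \<i>)
                                (1 + complex_of_real (sqrt (real q)) * \<i>) (1 - of_nat q)
           + A_poly p k (1::'a) (1 + complex_of_real (sqrt (real q)) * \<i>)
                                (1 - complex_of_real (sqrt (real q)) * \<i>) (1 - of_nat q)))"
proof -
  have "CHAR('a) dvd p ^ s" using CHAR_dvd_CARD[where ?'a='a] assms by simp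
  then have char: "CHAR('a) = p"
    using prime_CHAR_finite[where ?'a='a] \<open>prime p\<close> prime_dvd_power primes_dvd_imp_eq by blast
  have odd_card: "odd CARD('a)" using assms by simp
  obtain \<psi> :: "'a \<Rightarrow> complex" where "nontrivial_additive_character \<psi>"
    using nontrivial_additive_character_exists[of s, where ?'a='a] assms char by auto
  then interpret nontrivial_additive_character \<psi> .
  define g where "g = gauss 1"
  define r where "r = complex_of_real (sqrt (real q))"
  have r2: "r\<^sup>2 = of_nat q"
    by (simp add: r_def flip: of_real_power)
  \<comment> \<open>Only the square of the Gauss sum matters: replacing \<open>h\<close> by
    \<open>- h\<close> swaps the two summands.\<close>
  have main: "of_nat (num_distinct_nonzero_sols k (0::'a)) =
      falling_fact (of_nat q - 1) k / of_nat q
      + (-1) ^ k * ((of_nat q - 1) / (2 * of_nat q)) *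
        (A_poly p k (1::'a) (1 - h) (1 + h) (1 - of_nat q)
       + A_poly p k (1::'a) (1 + h) (1 - h) (1 - of_nat q))" if "g\<^sup>2 = h\<^sup>2" for h
  proof -
    have "g = h \<or> g = - h" using that by (simp add: power2_eq_iff)
    then show ?thesis
      using num_distinct_nonzero_sols_0[OF odd_card, of k] assms(5) char
      by (auto simp: g_def[symmetric] add.commute)
  qed
  have g_sq: "(-1) ^ ((q - 1) div 2) * g\<^sup>2 = of_nat q"
  proof -
    have "gauss (-1) = (-1) ^ ((q - 1) div 2) * g"
      using gauss_eq_quad_char[OF odd_card, of "-1"] quad_char_neg_1[OF odd_card]
      by (simp add: g_def assms(5))
    then show ?thesis
      using gauss_mult_gauss_neg[OF odd_card]
      by (simp add: g_def assms(5) power2_eq_square mult_ac)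
  qed
  \<comment> \<open>The sign of the squared Gauss sum depends on the parity of (q - 1)/2, hence on q
    modulo 4.\<close>
  have pow3: "(3::nat) ^ s mod 4 = (if even s then 1 else 3)"
  proof (induction s)
    case (Suc s)
    have "(3::nat) ^ Suc s mod 4 = 3 * (3 ^ s mod 4) mod 4" by (simp add: mod_mult_right_eq)
    then show ?case by (simp add: Suc.IH)
  qed simp
  have "g\<^sup>2 = r\<^sup>2" if "[p = 1] (mod 4) \<or> ([p = 3] (mod 4) \<and> even s)"
  proof -
    have "q mod 4 = 1"
      using that pow3 assms(4) power_mod[of p 4 s] by (auto simp: cong_def)
    then have "even ((q - 1) div 2)" by presburger
    then show ?thesis using g_sq r2 by simp
  qed
  moreover have "g\<^sup>2 = (r * \<i>)\<^sup>2" if "[p = 3] (mod 4) \<and> odd s"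
  proof -
    have "q mod 4 = 3"
      using that pow3 assms(4) power_mod[of p 4 s] by (auto simp: cong_def)
    then have "odd ((q - 1) div 2)" by presburger
    then have "g\<^sup>2 = - of_nat q" using g_sq by (simp add: minus_equation_iff)
    then show ?thesis using r2 by (simp add: power_mult_distrib)
  qed
  ultimately show ?thesis
    using main unfolding r_def by blast
qed

end
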